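(* Let $N\ge 3$ be an integer, $M=N-1$, let $K_{\max}\ge 1$ be an integer, let $R\in\mathbb N$ and $w\in\{1,\dots,R\}$. There exists a bidirectionally feasible schedule $\bm X\in\{0,1\}^{R\times M}$ for the $M$ non-reference nodes, all of whose codewords (columns) have weight exactly $w$, and which satisfies $K_r\le K_{\max}$ for all $r\in[R]$, if and only if $$\binom{R}{w}\ge M\qquad\text{and}\qquad Mw\le RK_{\max}.$$
   Context: $\mathbb N$ is the set of positive integers and $[R]=\{1,\dots,R\}$. The nodes are $\{1,\dots,N\}$; node $1$ is the reference node and nodes $2,\dots,N$ are the non-reference nodes. A schedule with $R$ rounds is a binary matrix $\bm X=[\bm\chi_2,\dots,\bm\chi_N]\in\{0,1\}^{R\times(N-1)}$ whose columns are codewords $\bm\chi_n=[\chi_{n,1},\dots,\chi_{n,R}]^{\mathrm T}$; $\chi_{n,r}=1$ means node $n$ transmits in round $r$, and $\chi_{n,r}=0$ means it listens. The weight of a codeword is its number of ones. The number of transmitters in round $r$ is $K_r=\sum_{n=2}^N\chi_{n,r}$. The schedule is bidirectionally feasible (i.e. directional requirement $q=1$) if $\Gamma_{n_1\to n_2}(\bm X)=\sum_{r=1}^R\chi_{n_1,r}(1-\chi_{n_2,r})\ge 1$ for all ordered pairs of distinct $n_1,n_2\in\{2,\dots,N\}$. *)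

theory Defs
  imports Complex_Main
begin

text \<open>
  A schedule is given by its columns: \<open>X n\<close> is the codeword of the non-reference node
  \<open>n \<in> {2..N}\<close>, and \<open>X n r\<close> is its entry for round \<open>r \<in> {1..R}\<close> (1: transmit, 0: listen).
  Values of \<open>X\<close> outside these index ranges carry no meaning, and none of the definitions
  below refers to them. Entries are integers so that \<open>1 - X n r\<close> is not truncated.
\<close>

definition is_schedule :: "nat \<Rightarrow> nat \<Rightarrow> (nat \<Rightarrow> nat \<Rightarrow> int) \<Rightarrow> bool" where
  "is_schedule N R X \<longleftrightarrow> (\<forall>n\<in>{2..N}. \<forall>r\<in>{1..R}. X n r \<in> {0, 1})"

definition weight :: "nat \<Rightarrow> (nat \<Rightarrow> int) \<Rightarrow> nat" where
  "weight R \<chi> = card {r \<in> {1..R}. \<chi> r = 1}"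

definition transmitters :: "nat \<Rightarrow> (nat \<Rightarrow> nat \<Rightarrow> int) \<Rightarrow> nat \<Rightarrow> int" where
  "transmitters N X r = (\<Sum>n=2..N. X n r)"

definition Gamma_dir :: "nat \<Rightarrow> (nat \<Rightarrow> nat \<Rightarrow> int) \<Rightarrow> nat \<Rightarrow> nat \<Rightarrow> int" where
  "Gamma_dir R X n1 n2 = (\<Sum>r=1..R. X n1 r * (1 - X n2 r))"

definition bidirectionally_feasible :: "nat \<Rightarrow> nat \<Rightarrow> (nat \<Rightarrow> nat \<Rightarrow> int) \<Rightarrow> bool" where
  "bidirectionally_feasible N R X \<longleftrightarrow>
     (\<forall>n1\<in>{2..N}. \<forall>n2\<in>{2..N}. n1 \<noteq> n2 \<longrightarrow> Gamma_dir R X n1 n2 \<ge> 1)"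

end

theory Submission
  imports Defs
begin

text \<open>
  Identify a codeword with the set of rounds in which it transmits. For codewords of equal weight,
  bidirectional feasibility says that these sets are distinct, so both conditions are necessary by
  counting. Conversely, take \<open>M\<close> distinct \<open>w\<close>-sets for which the total excess of the round loads
  over \<open>K_max\<close> is minimal. If some round \<open>a\<close> is overloaded, then some round \<open>b\<close> has load below
  \<open>K_max\<close>; as \<open>a\<close> lies in more sets than \<open>b\<close>, replacing \<open>a\<close> by \<open>b\<close> in a suitable set yields
  a set not yet in the family, and this exchange lowers the excess.
\<close>

definition degree :: "'a set set \<Rightarrow> 'a \<Rightarrow> nat" where
  "degree F r = card {S \<in> F. r \<in> S}"

lemma sum_degree:
  assumes "finite V" and "finite F" and "\<And>S. S \<in> F \<Longrightarrow> S \<subseteq> V"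
  shows "(\<Sum>r\<in>V. degree F r) = (\<Sum>S\<in>F. card S)"
  unfolding degree_def
proof (rule sum_multicount_gen[OF assms(1,2)], intro ballI)
  fix S assume "S \<in> F"
  then have "{r \<in> V. r \<in> S} = S" using assms(3) by blast
  then show "card {r \<in> V. r \<in> S} = card S" by simp
qed

text \<open>If every such exchange stayed inside \<open>F\<close>, exchanging \<open>a\<close> for
  \<open>b\<close> would map the members containing \<open>a\<close> injectively to members
  containing \<open>b\<close>, so \<open>a\<close> could not have the larger degree.\<close>

lemma exists_exchange:
  assumes "finite F" and "degree F b < degree F a"
  shows "\<exists>S\<in>F. a \<in> S \<and> b \<notin> S \<and> insert b (S - {a}) \<notin> F"
proof (rule ccontr)
  assume "\<not> ?thesis"
  then have closed: "\<And>S. \<lbrakk>S \<in> F; a \<in> S; b \<notin> S\<rbrakk> \<Longrightarrow> insert b (S - {a}) \<in> F" by blast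
  define g where "g S = (if b \<in> S then S else insert b (S - {a}))" for S
  have "a \<noteq> b" using assms(2) by auto
  have "inj_on g {S \<in> F. a \<in> S}"
  proof (rule inj_on_inverseI)
    fix S assume "S \<in> {S \<in> F. a \<in> S}"
    \<comment> \<open>A left inverse: since \<open>a\<close> lies in \<open>S\<close>, it survives
      in \<open>g S\<close> exactly when \<open>b\<close> was already in \<open>S\<close>, so
      \<open>g S\<close> reveals which branch was taken.\<close>
    then show "(if a \<in> g S then g S else insert a (g S - {b})) = S"
      using \<open>a \<noteq> b\<close> by (auto simp: g_def)
  qed
  moreover have "g ` {S \<in> F. a \<in> S} \<subseteq> {S \<in> F. b \<in> S}"
    using closed by (auto simp: g_def)
  ultimately have "degree F a \<le> degree F b"
    unfolding degree_def using assms(1) by (intro card_inj_on_le) auto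
  with assms(2) show False by simp
qed

lemma degree_insert:
  assumes "finite F" and "T \<notin> F"
  shows "degree (insert T F) r = degree F r + of_bool (r \<in> T)"
proof -
  have "{S \<in> insert T F. r \<in> S} = (if r \<in> T then insert T {S \<in> F. r \<in> S} else {S \<in> F. r \<in> S})"
    by auto
  then show ?thesis using assms by (simp add: degree_def)
qed

lemma exists_balanced_family:
  fixes V :: "'a set"
  assumes "finite V" and "M \<le> card V choose w" and "M * w \<le> card V * K"
  shows "\<exists>F. F \<subseteq> {S. S \<subseteq> V \<and> card S = w} \<and> card F = M \<and> (\<forall>r\<in>V. degree F r \<le> K)"
proof -
  define U where "U = {S. S \<subseteq> V \<and> card S = w}"
  have finU: "finite U" using assms(1) by (simp add: U_def)
  have "M \<le> card U" using assms(1,2) by (simp add: U_def n_subsets)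
  then obtain F0 where F0: "F0 \<subseteq> U \<and> card F0 = M"
    using obtain_subset_with_card_n by metis
  \<comment> \<open>The subtraction is truncated: points of degree at most \<open>K\<close>
    contribute 0, and spare capacity cannot offset an overload elsewhere.\<close>
  define excess where "excess F = (\<Sum>r\<in>V. degree F r - K)" for F
  have "\<exists>F. (F \<subseteq> U \<and> card F = M) \<and> (\<forall>G. G \<subseteq> U \<and> card G = M \<longrightarrow> excess F \<le> excess G)"
    using F0 by (rule ex_has_least_nat)
  then obtain F where F: "F \<subseteq> U" "card F = M"
    and least: "\<And>G. \<lbrakk>G \<subseteq> U; card G = M\<rbrakk> \<Longrightarrow> excess F \<le> excess G"
    by auto
  have finF: "finite F" using F(1) finU finite_subset by blast
  have "degree F a \<le> K" if "a \<in> V" for a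
  proof (rule ccontr)
    assume "\<not> degree F a \<le> K"
    then have over: "degree F a > K" by simp
    have "(\<Sum>r\<in>V. degree F r) = M * w"
      using sum_degree[OF assms(1) finF] F by (auto simp: U_def subset_iff)
    then have total: "(\<Sum>r\<in>V. degree F r) \<le> (\<Sum>r\<in>V. K)" using assms(3) by simp
    \<comment> \<open>Otherwise all degrees are at least \<open>K\<close> and that of
      \<open>a\<close> is larger, so their sum exceeds \<open>card V * K\<close>.\<close>
    have "\<exists>b\<in>V. degree F b < K"
    proof (rule ccontr)
      assume "\<not> ?thesis"
      then have "(\<Sum>r\<in>V. K) < (\<Sum>r\<in>V. degree F r)"
        using over \<open>a \<in> V\<close> assms(1) by (intro sum_strict_mono_ex1) (auto simp: not_less)
      with total show False by simp
    qed
    then obtain b where b: "b \<in> V" "degree F b < K" by blast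
    with over obtain S where S: "S \<in> F" "a \<in> S" "b \<notin> S" "insert b (S - {a}) \<notin> F"
      using exists_exchange[OF finF, of b a] by auto
    define T where "T = insert b (S - {a})"
    define G where "G = insert T (F - {S})"
    have SU: "S \<subseteq> V" "card S = w" using S(1) F(1) by (auto simp: U_def)
    have "finite S" using SU(1) assms(1) finite_subset by blast
    then have "card T = w"
      using S(2,3) SU(2) card_Suc_Diff1[of S a] by (simp add: T_def)
    then have "G \<subseteq> U" using F(1) SU b(1) by (auto simp: G_def T_def U_def)
    \<comment> \<open>As \<open>T\<close> is not in \<open>F\<close>, adding it makes up for the
      removal of \<open>S\<close>.\<close>
    moreover have "card G = M"
      using S F(2) finF card_Suc_Diff1[of F S] by (simp add: G_def T_def)
    ultimately have "excess F \<le> excess G" by (rule least)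
    \<comment> \<open>Both \<open>F\<close> and \<open>G\<close> arise from \<open>F - {S}\<close>
      by inserting one new set. The additive form avoids truncated subtraction.\<close>
    moreover have deg: "degree G r + of_bool (r \<in> S) = degree F r + of_bool (r \<in> T)" for r
      using degree_insert[of "F - {S}" T r] degree_insert[of "F - {S}" S r] S finF
      by (simp add: G_def T_def insert_absorb)
    have "excess G < excess F"
      unfolding excess_def
    proof (rule sum_strict_mono_ex1[OF assms(1)])
      \<comment> \<open>Only the degree of \<open>b\<close> grows, by one; having been below
        \<open>K\<close>, it still contributes 0.\<close>
      show "\<forall>r\<in>V. degree G r - K \<le> degree F r - K"
      proof
        fix r
        show "degree G r - K \<le> degree F r - K"
          using deg[of r] b(2) S(3) by (cases "r = b") (auto simp: T_def of_bool_def split: if_splits)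
      qed
      \<comment> \<open>The degree of \<open>a\<close> drops by one from a value above
        \<open>K\<close>, so truncation does not hide the decrease.\<close>
      have "a \<noteq> b" using S by blast
      then have "degree G a - K < degree F a - K"
        using deg[of a] over S(2) by (simp add: T_def)
      then show "\<exists>r\<in>V. degree G r - K < degree F r - K" using \<open>a \<in> V\<close> by blast
    qed
    ultimately show False by simp
  qed
  with F show ?thesis unfolding U_def by blast
qed

definition support :: "nat \<Rightarrow> (nat \<Rightarrow> int) \<Rightarrow> nat set" where
  "support R \<chi> = {r \<in> {1..R}. \<chi> r = 1}"

lemma weight_eq_card_support: "weight R \<chi> = card (support R \<chi>)"
  by (simp add: weight_def support_def)

text \<open>With entries 0 and 1, each summand is the indicator of transmitting in the first
  codeword and listening in the second.\<close>

lemma Gamma_dir_eq_card: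
  assumes "is_schedule N R X" and "n1 \<in> {2..N}" and "n2 \<in> {2..N}"
  shows "Gamma_dir R X n1 n2 = int (card (support R (X n1) - support R (X n2)))"
proof -
  have "Gamma_dir R X n1 n2
      = (\<Sum>r\<in>{1..R}. if r \<in> support R (X n1) - support R (X n2) then 1 else 0)"
    unfolding Gamma_dir_def using assms
    by (intro sum.cong) (fastforce simp: is_schedule_def support_def)+
  also have "\<dots> = int (card ({1..R} \<inter> (support R (X n1) - support R (X n2))))"
    by (simp add: sum.If_cases set_diff_eq)
  also have "{1..R} \<inter> (support R (X n1) - support R (X n2)) = support R (X n1) - support R (X n2)"
    by (auto simp: support_def)
  finally show ?thesis .
qed

lemma transmitters_eq_card:
  assumes "is_schedule N R X" and "r \<in> {1..R}"
  shows "transmitters N X r = int (card {n \<in> {2..N}. r \<in> support R (X n)})"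
proof -
  have "transmitters N X r = (\<Sum>n\<in>{2..N}. if r \<in> support R (X n) then 1 else 0)"
    unfolding transmitters_def using assms
    by (intro sum.cong) (fastforce simp: is_schedule_def support_def)+
  then show ?thesis by (simp add: sum.If_cases Int_def)
qed

text \<open>Feasibility forbids one support from lying inside another. Between finite sets of equal
  size, inclusion already forces equality, so this reduces to distinctness.\<close>

lemma bidirectionally_feasible_iff_inj_on:
  assumes "is_schedule N R X" and "\<forall>n\<in>{2..N}. weight R (X n) = w"
  shows "bidirectionally_feasible N R X \<longleftrightarrow> inj_on (\<lambda>n. support R (X n)) {2..N}"
proof -
  have fin: "finite (support R \<chi>)" for \<chi> by (simp add: support_def)
  have "Gamma_dir R X n1 n2 \<ge> 1 \<longleftrightarrow> support R (X n1) \<noteq> support R (X n2)"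
    if n: "n1 \<in> {2..N}" "n2 \<in> {2..N}" for n1 n2
  proof -
    have "card (support R (X n1)) = card (support R (X n2))"
      using assms(2) n by (simp add: weight_eq_card_support)
    then have "support R (X n1) \<subseteq> support R (X n2) \<longleftrightarrow> support R (X n1) = support R (X n2)"
      using card_subset_eq[OF fin] by blast
    moreover have "Gamma_dir R X n1 n2 \<ge> 1 \<longleftrightarrow> \<not> support R (X n1) \<subseteq> support R (X n2)"
      using fin by (simp add: Gamma_dir_eq_card[OF assms(1) n] Suc_le_eq card_gt_0_iff)
    ultimately show ?thesis by simp
  qed
  then show ?thesis unfolding bidirectionally_feasible_def inj_on_def by blast
qed

theorem theorem2:
  fixes N M K_max R w :: nat
  assumes "N \<ge> 3" and "M = N - 1" and "K_max \<ge> 1" and "R \<ge> 1" and "w \<in> {1..R}"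
  shows "(\<exists>X. is_schedule N R X \<and> bidirectionally_feasible N R X
             \<and> (\<forall>n\<in>{2..N}. weight R (X n) = w)
             \<and> (\<forall>r\<in>{1..R}. transmitters N X r \<le> int K_max))
         \<longleftrightarrow> (R choose w \<ge> M \<and> M * w \<le> R * K_max)"
    (is "?lhs \<longleftrightarrow> ?rhs")
proof -
  have cardN: "card {2..N} = M" using assms(1,2) by simp
  show ?thesis
  proof
    assume ?lhs
    then obtain X where X: "is_schedule N R X" "bidirectionally_feasible N R X"
      and wt: "\<forall>n\<in>{2..N}. weight R (X n) = w"
      and load: "\<forall>r\<in>{1..R}. transmitters N X r \<le> int K_max" by blast
    define A where "A n = support R (X n)" for n
    have A: "A n \<subseteq> {1..R}" for n by (auto simp: A_def support_def)
    have cardA: "card (A n) = w" if "n \<in> {2..N}" for n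
      using that wt by (simp add: A_def weight_eq_card_support)
    have "inj_on A {2..N}"
      using X wt bidirectionally_feasible_iff_inj_on unfolding A_def by blast
    \<comment> \<open>The supports are \<open>M\<close> distinct \<open>w\<close>-subsets of the
      rounds.\<close>
    then have "M \<le> card {S. S \<subseteq> {1..R} \<and> card S = w}"
      unfolding cardN[symmetric] using A cardA by (intro card_inj_on_le) auto
    \<comment> \<open>Pairs of a round and a node transmitting in it are counted by rounds and by
      nodes.\<close>
    moreover have "(\<Sum>r\<in>{1..R}. card {n \<in> {2..N}. r \<in> A n}) = w * card {2..N}"
    proof (rule sum_multicount, simp_all only: finite_atLeastAtMost, intro ballI)
      fix n assume n: "n \<in> {2..N}"
      have "{r \<in> {1..R}. r \<in> A n} = A n" using A by blast
      then show "card {r \<in> {1..R}. r \<in> A n} = w" using cardA[OF n] by simp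
    qed
    moreover have "(\<Sum>r\<in>{1..R}. card {n \<in> {2..N}. r \<in> A n}) \<le> (\<Sum>r\<in>{1..R}. K_max)"
    proof (rule sum_mono)
      fix r assume "r \<in> {1..R}"
      then show "card {n \<in> {2..N}. r \<in> A n} \<le> K_max"
        using load transmitters_eq_card[OF X(1)] by (fastforce simp: A_def)
    qed
    ultimately show ?rhs unfolding cardN by (simp add: n_subsets mult.commute)
  next
    assume ?rhs
    then obtain F where F: "F \<subseteq> {S. S \<subseteq> {1..R} \<and> card S = w}" "card F = M"
      and deg: "\<forall>r\<in>{1..R}. degree F r \<le> K_max"
      using exists_balanced_family[of "{1..R}" M w K_max] by auto
    have "finite F" using F(1) by (rule finite_subset) simp
    \<comment> \<open>The balanced family is distributed among the nodes, one set each, and the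
      codewords are the indicator functions.\<close>
    then obtain f where f: "bij_betw f {2..N} F"
      using finite_same_card_bij[of "{2..N}" F] F(2) cardN by auto
    define X where "X n r = (if r \<in> f n then 1 else 0 :: int)" for n r
    have f_in: "f n \<subseteq> {1..R} \<and> card (f n) = w" if "n \<in> {2..N}" for n
      using F(1) bij_betwE[OF f] that by blast
    have supp: "support R (X n) = f n" if "n \<in> {2..N}" for n
    proof -
      have "f n \<subseteq> {1..R}" using f_in[OF that] by blast
      then show ?thesis by (auto simp: support_def X_def)
    qed
    have sched: "is_schedule N R X" by (simp add: is_schedule_def X_def)
    have wt: "\<forall>n\<in>{2..N}. weight R (X n) = w"
      using f_in supp by (simp add: weight_eq_card_support)
    have "inj_on (\<lambda>n. support R (X n)) {2..N}"
      using bij_betw_imp_inj_on[OF f] supp by (simp add: inj_on_def)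
    then have "bidirectionally_feasible N R X"
      using bidirectionally_feasible_iff_inj_on[OF sched wt] by simp
    moreover have "transmitters N X r \<le> int K_max" if r: "r \<in> {1..R}" for r
    proof -
      \<comment> \<open>\<open>f\<close> sends the nodes transmitting in round \<open>r\<close>
        injectively to members of \<open>F\<close> containing \<open>r\<close>.\<close>
      have "card {n \<in> {2..N}. r \<in> support R (X n)} \<le> degree F r"
        unfolding degree_def
      proof (rule card_inj_on_le)
        show "inj_on f {n \<in> {2..N}. r \<in> support R (X n)}"
          using bij_betw_imp_inj_on[OF f] by (rule inj_on_subset) auto
        show "f ` {n \<in> {2..N}. r \<in> support R (X n)} \<subseteq> {S \<in> F. r \<in> S}"
          using bij_betwE[OF f] supp by auto
        show "finite {S \<in> F. r \<in> S}" using \<open>finite F\<close> by simp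
      qed
      then show ?thesis using deg r transmitters_eq_card[OF sched r] by fastforce
    qed
    ultimately show ?lhs using sched wt by blast
  qed
qed

end
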